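(* Let $G=(C\cup I,E)$ be a connected split graph, where $C$ induces an inclusion-maximal clique and $I$ induces an independent set. Then $mh(G)=|C|-1$ if and only if there exists a simplicial vertex in $C$. Otherwise, $mh(G)=|C|$.
   Context: A vertex is simplicial if its neighbourhood induces a clique. Hunters and Rabbit game on a graph $G=(V,E)$. A hunter strategy is a finite sequence $(S_1,\dots,S_\ell)$ of non-empty subsets of $V$, using $\max_i|S_i|$ hunters. A rabbit trajectory is a walk $(r_0,\dots,r_\ell)$ in $G$ ($r_i\in N(r_{i-1})$); the strategy is winning if every rabbit trajectory has some $j<\ell$ with $r_j\in S_{j+1}$. Contaminated sets: $Z_0=V$, $Z_i=\{x : \exists y\in Z_{i-1}\setminus S_i,\ xy\in E\}$. A vertex $v$ is cleared at round $i$ if $v\in S_i$, or $N(v)\cap Z_{i-1}\ne\emptyset$ and $N(v)\cap Z_{i-1}\subseteq S_i$. A strategy is monotone if any vertex $v$ cleared at some round $i$ satisfies $v\in S_{j+1}$ whenever $j>i$ and $v\in Z_j$. $mh(G)$ is the minimum number of hunters of a monotone winning hunter strategy ($0$ for a single vertex). *)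

theory Defs
  imports Main
begin

(* Finite simple graphs: an edge is a two-element subset of the vertex set. *)

definition simple_graph :: "'a set \<Rightarrow> 'a set set \<Rightarrow> bool" where
  "simple_graph V E \<longleftrightarrow> finite V \<and> E \<subseteq> {e. e \<subseteq> V \<and> card e = 2}"

definition nbhd :: "'a set set \<Rightarrow> 'a \<Rightarrow> 'a set" where
  "nbhd E v = {u. {u, v} \<in> E}"

definition connected_graph :: "'a set \<Rightarrow> 'a set set \<Rightarrow> bool" where
  "connected_graph V E \<longleftrightarrow> V \<noteq> {} \<and> (\<forall>u\<in>V. \<forall>v\<in>V. (u, v) \<in> {(x, y). {x, y} \<in> E}\<^sup>*)"

definition clique :: "'a set \<Rightarrow> 'a set set \<Rightarrow> 'a set \<Rightarrow> bool" where
  "clique V E K \<longleftrightarrow> K \<subseteq> V \<and> (\<forall>u\<in>K. \<forall>v\<in>K. u \<noteq> v \<longrightarrow> {u, v} \<in> E)"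

definition maximal_clique :: "'a set \<Rightarrow> 'a set set \<Rightarrow> 'a set \<Rightarrow> bool" where
  "maximal_clique V E K \<longleftrightarrow> clique V E K \<and> (\<forall>D. clique V E D \<and> K \<subseteq> D \<longrightarrow> D = K)"

definition independent_set :: "'a set \<Rightarrow> 'a set set \<Rightarrow> 'a set \<Rightarrow> bool" where
  "independent_set V E J \<longleftrightarrow> J \<subseteq> V \<and> (\<forall>u\<in>J. \<forall>v\<in>J. {u, v} \<notin> E)"

definition simplicial :: "'a set \<Rightarrow> 'a set set \<Rightarrow> 'a \<Rightarrow> bool" where
  "simplicial V E v \<longleftrightarrow> v \<in> V \<and> clique V E (nbhd E v)"

(* Hunters and Rabbit. A strategy (S_1, ..., S_l) is a list S of length l,
   so the set S_i shot at round i >= 1 is S ! (i - 1), and S_(j+1) is S ! j. *)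

definition hunter_strategy :: "'a set \<Rightarrow> 'a set list \<Rightarrow> bool" where
  "hunter_strategy V S \<longleftrightarrow> S \<noteq> [] \<and> (\<forall>X\<in>set S. X \<noteq> {} \<and> X \<subseteq> V)"

definition hunters_used :: "'a set list \<Rightarrow> nat" where
  "hunters_used S = Max (card ` set S)"

(* The walk (r_0, ..., r_l) has l + 1 vertices. *)

definition rabbit_trajectory :: "'a set \<Rightarrow> 'a set set \<Rightarrow> nat \<Rightarrow> 'a list \<Rightarrow> bool" where
  "rabbit_trajectory V E l r \<longleftrightarrow> length r = l + 1 \<and> set r \<subseteq> V \<and>
     (\<forall>i\<in>{1..l}. r ! i \<in> nbhd E (r ! (i - 1)))"

definition winning :: "'a set \<Rightarrow> 'a set set \<Rightarrow> 'a set list \<Rightarrow> bool" where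
  "winning V E S \<longleftrightarrow>
     (\<forall>r. rabbit_trajectory V E (length S) r \<longrightarrow> (\<exists>j<length S. r ! j \<in> S ! j))"

(* The contaminated set Z_i; meaningful only for i <= length S. *)

primrec contaminated :: "'a set \<Rightarrow> 'a set set \<Rightarrow> 'a set list \<Rightarrow> nat \<Rightarrow> 'a set" where
  "contaminated V E S 0 = V"
| "contaminated V E S (Suc i) = {x \<in> V. \<exists>y \<in> contaminated V E S i - S ! i. {x, y} \<in> E}"

definition cleared_at :: "'a set \<Rightarrow> 'a set set \<Rightarrow> 'a set list \<Rightarrow> nat \<Rightarrow> 'a \<Rightarrow> bool" where
  "cleared_at V E S i v \<longleftrightarrow> i \<in> {1..length S} \<and> v \<in> V \<and>
     (v \<in> S ! (i - 1) \<or>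
      (nbhd E v \<inter> contaminated V E S (i - 1) \<noteq> {} \<and>
       nbhd E v \<inter> contaminated V E S (i - 1) \<subseteq> S ! (i - 1)))"

(* The condition on j requires S_(j+1) to exist; for a winning strategy of length l
   nothing is lost, since then Z_l is empty. *)

definition monotone_strategy :: "'a set \<Rightarrow> 'a set set \<Rightarrow> 'a set list \<Rightarrow> bool" where
  "monotone_strategy V E S \<longleftrightarrow>
     (\<forall>v i j. cleared_at V E S i v \<longrightarrow> i < j \<longrightarrow> j < length S \<longrightarrow>
        v \<in> contaminated V E S j \<longrightarrow> v \<in> S ! j)"

(* For nonempty finite V the one-round strategy [V] is monotone and winning,
   so LEAST ranges over a nonempty set. *)

definition mh :: "'a set \<Rightarrow> 'a set set \<Rightarrow> nat" where
  "mh V E = (if card V = 1 then 0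
     else (LEAST k. \<exists>S. hunter_strategy V S \<and> winning V E S \<and> monotone_strategy V E S \<and>
                        hunters_used S = k))"

end

theory Submission
  imports Defs
begin

text \<open>
  Shooting \<open>C\<close> twice wins, and so does shooting \<open>C - {v}\<close> twice when \<open>v \<in> C\<close> is simplicial, which by
  maximality of \<open>C\<close> means that \<open>v\<close> has no neighbour in \<open>I\<close>.

  Conversely, as long as two vertices of a contaminated clique escape each shot, the clique stays
  contaminated; hence \<open>|C| - 1\<close> hunters are needed. Suppose that \<open>|C| - 1\<close> hunters win monotonically
  and that every vertex of \<open>C\<close> has a neighbour in \<open>I\<close>. At the first round after which some \<open>v \<in> C\<close> is
  not contaminated, exactly \<open>C - {v}\<close> is shot. All neighbours of \<open>v\<close> in \<open>I\<close> were therefore cleared in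
  the round before, are contaminated again by \<open>v\<close>, and by monotonicity must be shot next. So
  some \<open>u \<in> C - {v}\<close> escapes, and one round later exactly \<open>C - {u}\<close> has to be shot. But the
  neighbours of \<open>u\<close> in \<open>I\<close>, cleared earlier, are contaminated then and must be shot as well.
\<close>

section \<open>Contaminated sets as positions of surviving rabbits\<close>

lemma contaminated_subset: "contaminated V E S i \<subseteq> V"
  by (cases i) auto

lemma contaminated_SucI:
  assumes "y \<in> contaminated V E S i" "y \<notin> S ! i" "{x, y} \<in> E" "x \<in> V"
  shows "x \<in> contaminated V E S (Suc i)"
  using assms by auto

lemma contaminated_imp_trajectory:
  assumes "x \<in> contaminated V E S i"
  shows "\<exists>r. rabbit_trajectory V E i r \<and> r ! i = x \<and> (\<forall>j<i. r ! j \<notin> S ! j)"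
  using assms
proof (induction i arbitrary: x)
  case 0
  then show ?case
    by (intro exI[of _ "[x]"]) (simp add: rabbit_trajectory_def)
next
  case (Suc i)
  then obtain y where y: "y \<in> contaminated V E S i" "y \<notin> S ! i" "{x, y} \<in> E" "x \<in> V"
    by auto
  with Suc.IH obtain r where r: "rabbit_trajectory V E i r" "r ! i = y" "\<forall>j<i. r ! j \<notin> S ! j"
    by blast
  have len: "length r = Suc i"
    using r by (simp add: rabbit_trajectory_def)
  have step: "(r @ [x]) ! j \<in> nbhd E ((r @ [x]) ! (j - 1))" if "j \<in> {1..Suc i}" for j
    using that r y by (cases "j = Suc i") (auto simp: rabbit_trajectory_def nbhd_def nth_append)
  have "rabbit_trajectory V E (Suc i) (r @ [x])"
    using r y step by (auto simp: rabbit_trajectory_def)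
  moreover have "(r @ [x]) ! j \<notin> S ! j" if "j < Suc i" for j
    using that r y len by (cases "j = i") (auto simp: nth_append)
  ultimately show ?case
    using len by (intro exI[of _ "r @ [x]"]) (auto simp: nth_append)
qed

lemma trajectory_imp_contaminated:
  assumes "rabbit_trajectory V E l r" "\<forall>j<l. r ! j \<notin> S ! j" "i \<le> l"
  shows "r ! i \<in> contaminated V E S i"
  using assms(3)
proof (induction i)
  case 0
  have "r ! 0 \<in> set r"
    using assms(1) by (intro nth_mem) (simp add: rabbit_trajectory_def)
  then show ?case
    using assms(1) by (auto simp: rabbit_trajectory_def)
next
  case (Suc i)
  have "r ! Suc i \<in> set r"
    using assms(1) Suc.prems by (intro nth_mem) (simp add: rabbit_trajectory_def)
  moreover have "r ! Suc i \<in> nbhd E (r ! i)"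
    using assms(1) Suc.prems by (auto simp: rabbit_trajectory_def dest: bspec[of _ _ "Suc i"])
  ultimately show ?case
    using Suc assms by (intro contaminated_SucI[of "r ! i"]) (auto simp: rabbit_trajectory_def nbhd_def)
qed

text \<open>\<open>contaminated V E S i\<close> consists of the ends of the walks of length
  \<open>i\<close> that evade the first \<open>i\<close> shots, so walks can be forgotten from here
  on.\<close>

lemma winning_iff_contaminated_empty:
  "winning V E S \<longleftrightarrow> contaminated V E S (length S) = {}"
  unfolding winning_def
  using contaminated_imp_trajectory[of _ V E S "length S"]
    trajectory_imp_contaminated[of V E "length S" _ S "length S"] by blast

section \<open>Shots, monotonicity and bounds on \<open>mh\<close> in general graphs\<close>

lemma card_le_hunters_used:
  assumes "i < length S"
  shows "card (S ! i) \<le> hunters_used S"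
  using assms by (auto simp: hunters_used_def)

lemma finite_shot:
  assumes "finite V" "hunter_strategy V S" "i < length S"
  shows "finite (S ! i)"
  using assms by (meson hunter_strategy_def nth_mem finite_subset)

text \<open>The shot \<open>S ! i\<close> belongs to round \<open>Suc i\<close>, so it creates an
  obligation only from index \<open>Suc (Suc i)\<close> on.\<close>

lemma monotone_shotD:
  assumes "monotone_strategy V E S" "hunter_strategy V S" "v \<in> S ! i" "Suc i < j" "j < length S"
    and "v \<in> contaminated V E S j"
  shows "v \<in> S ! j"
proof -
  have "cleared_at V E S (Suc i) v"
    using assms contaminated_subset[of V E S j] by (auto simp: cleared_at_def)
  then show ?thesis
    using assms unfolding monotone_strategy_def by blast
qed

lemma monotone_surroundedD:
  assumes "monotone_strategy V E S" "nbhd E v \<inter> contaminated V E S i \<noteq> {}"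
    and "nbhd E v \<inter> contaminated V E S i \<subseteq> S ! i" "Suc i < j" "j < length S"
    and "v \<in> contaminated V E S j"
  shows "v \<in> S ! j"
proof -
  have "cleared_at V E S (Suc i) v"
    using assms contaminated_subset[of V E S j] by (auto simp: cleared_at_def)
  then show ?thesis
    using assms unfolding monotone_strategy_def by blast
qed

lemma winning_clique_bound:
  assumes "finite V" "clique V E K" "hunter_strategy V S" "winning V E S"
  shows "card K - 1 \<le> hunters_used S"
proof (rule ccontr)
  assume "\<not> ?thesis"
  then have few: "hunters_used S + 1 < card K"
    by simp
  have K: "K \<subseteq> V" "finite K"
    using assms by (auto simp: clique_def finite_subset)
  have "K \<subseteq> contaminated V E S i" if "i \<le> length S" for i
    using that
  proof (induction i)
    case 0
    then show ?case using K by simp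
  next
    case (Suc i)
    \<comment> \<open>At least two vertices of \<open>K\<close> escape the shot, so one of them
      differs from \<open>x\<close>.\<close>
    have escape: "\<exists>y\<in>K. y \<noteq> x \<and> y \<notin> S ! i" for x
    proof (rule ccontr)
      assume "\<not> ?thesis"
      then have "K \<subseteq> insert x (S ! i)"
        by auto
      moreover have "finite (S ! i)"
        using finite_shot[OF assms(1,3)] Suc.prems by simp
      ultimately have "card K \<le> Suc (card (S ! i))"
        using card_mono[of "insert x (S ! i)" K] by (auto simp: card_insert_if split: if_splits)
      then show False
        using few card_le_hunters_used[of i S] Suc.prems by simp
    qed
    show ?case
    proof
      fix x assume x: "x \<in> K"
      obtain y where "y \<in> K" "y \<noteq> x" "y \<notin> S ! i"
        using escape by blast
      then show "x \<in> contaminated V E S (Suc i)"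
        using x K Suc assms(2) by (intro contaminated_SucI[of y]) (auto simp: clique_def)
    qed
  qed
  then have "K = {}"
    using assms(4) by (auto simp: winning_iff_contaminated_empty)
  then show False
    using few by simp
qed

lemma mh_eqI:
  assumes "card V \<noteq> 1" "hunter_strategy V S" "winning V E S" "monotone_strategy V E S"
    and "hunters_used S = k"
    and "\<And>T. hunter_strategy V T \<Longrightarrow> winning V E T \<Longrightarrow> monotone_strategy V E T \<Longrightarrow> k \<le> hunters_used T"
  shows "mh V E = k"
  unfolding mh_def using assms by (auto intro!: Least_equality)

text \<open>\<open>X\<close> is a vertex cover: a rabbit that evades the first shot is outside
  \<open>X\<close>, so it moves into \<open>X\<close> and is hit by the second. Monotonicity is
  vacuous for two rounds, as no index satisfies \<open>1 \<le> i < j < 2\<close>.\<close>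

lemma mh_eq_two_shots:
  assumes "card V \<noteq> 1" "X \<noteq> {}" "X \<subseteq> V"
    and "\<And>x y. {x, y} \<in> E \<Longrightarrow> x \<notin> X \<Longrightarrow> y \<in> X"
    and "\<And>T. hunter_strategy V T \<Longrightarrow> winning V E T \<Longrightarrow> monotone_strategy V E T \<Longrightarrow> card X \<le> hunters_used T"
  shows "mh V E = card X"
proof (rule mh_eqI[where S = "[X, X]"])
  show "hunter_strategy V [X, X]" "hunters_used [X, X] = card X"
    using assms by (auto simp: hunter_strategy_def hunters_used_def)
  show "winning V E [X, X]"
    using assms(4) by (auto simp: winning_iff_contaminated_empty insert_commute)
  show "monotone_strategy V E [X, X]"
    by (auto simp: monotone_strategy_def cleared_at_def)
qed (use assms in auto)

section \<open>Connected split graphs\<close>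

locale split_graph =
  fixes C I :: "'a set" and E :: "'a set set"
  assumes simple: "simple_graph (C \<union> I) E"
    and connected: "connected_graph (C \<union> I) E"
    and disjoint: "C \<inter> I = {}"
    and maximal: "maximal_clique (C \<union> I) E C"
    and independent: "independent_set (C \<union> I) E I"
begin

lemma finite_V: "finite (C \<union> I)"
  using simple by (simp add: simple_graph_def)

lemma finite_C: "finite C"
  using finite_V by simp

lemma edge_in_V: "{x, y} \<in> E \<Longrightarrow> x \<in> C \<union> I \<and> y \<in> C \<union> I \<and> x \<noteq> y"
  using simple by (auto simp: simple_graph_def)

lemma edge_meets_C: "{x, y} \<in> E \<Longrightarrow> x \<in> C \<or> y \<in> C"
  using edge_in_V[of x y] independent by (auto simp: independent_set_def)

lemma clique_C: "clique (C \<union> I) E C"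
  using maximal by (simp add: maximal_clique_def)

lemma clique_edge: "x \<in> C \<Longrightarrow> y \<in> C \<Longrightarrow> x \<noteq> y \<Longrightarrow> {x, y} \<in> E"
  using clique_C by (simp add: clique_def)

lemma C_nonempty: "C \<noteq> {}"
proof
  assume "C = {}"
  obtain x where x: "x \<in> C \<union> I"
    using connected by (auto simp: connected_graph_def)
  then have "clique (C \<union> I) E {x}"
    by (auto simp: clique_def)
  then show False
    using maximal \<open>C = {}\<close> by (auto simp: maximal_clique_def)
qed

text \<open>A neighbour of a simplicial \<open>v\<close> in \<open>I\<close> would be adjacent to
  all of \<open>C\<close> and so extend this maximal clique.\<close>

lemma simplicial_iff_no_outer_neighbour:
  assumes "v \<in> C"
  shows "simplicial (C \<union> I) E v \<longleftrightarrow> (\<forall>w\<in>I. {w, v} \<notin> E)"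
proof
  assume simp: "simplicial (C \<union> I) E v"
  show "\<forall>w\<in>I. {w, v} \<notin> E"
  proof (rule ballI, rule notI)
    fix w assume w: "w \<in> I" "{w, v} \<in> E"
    have "{x, w} \<in> E" if "x \<in> C" for x
    proof (cases "x = v")
      case False
      then have "x \<in> nbhd E v" "w \<in> nbhd E v" "x \<noteq> w"
        using that w clique_edge assms disjoint by (auto simp: nbhd_def)
      then show ?thesis
        using simp by (auto simp: simplicial_def clique_def)
    qed (use w in \<open>simp add: insert_commute\<close>)
    then have "clique (C \<union> I) E (insert w C)"
      using w clique_C by (auto simp: clique_def insert_commute)
    then have "insert w C = C"
      using maximal by (auto simp: maximal_clique_def)
    then show False
      using w disjoint by auto
  qed
next
  assume "\<forall>w\<in>I. {w, v} \<notin> E"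
  then have "nbhd E v \<subseteq> C"
    using edge_in_V by (auto simp: nbhd_def)
  then show "simplicial (C \<union> I) E v"
    using assms clique_C by (auto simp: simplicial_def clique_def)
qed

lemma monotone_lower_bound:
  assumes outer: "\<forall>v\<in>C. \<exists>w\<in>I. {w, v} \<in> E"
    and S: "hunter_strategy (C \<union> I) S"
    and win: "winning (C \<union> I) E S"
    and mono: "monotone_strategy (C \<union> I) E S"
  shows "card C \<le> hunters_used S"
proof (rule ccontr)
  assume "\<not> ?thesis"
  then have few: "card (S ! i) < card C" if "i < length S" for i
    using card_le_hunters_used[OF that] by simp
  let ?Z = "contaminated (C \<union> I) E S"
  have fin: "finite (S ! i)" if "i < length S" for i
    using finite_shot[OF finite_V S that] .
  have end_empty: "?Z (length S) = {}"
    using win by (simp add: winning_iff_contaminated_empty)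
  have spread: "x \<in> ?Z (Suc i)" if "y \<in> ?Z i" "y \<notin> S ! i" "{x, y} \<in> E" for x y i
    using contaminated_SucI[OF that] edge_in_V[OF that(3)] by simp
  \<comment> \<open>\<open>C - {x}\<close> already has the largest size that a shot may
    have.\<close>
  have shot_eq: "S ! i = C - {x}" if "C - {x} \<subseteq> S ! i" "i < length S" "x \<in> C" for x i
    using card_seteq[OF fin that(1)] few[of i] that finite_C by auto
  define m where "m = (LEAST i. \<not> C \<subseteq> ?Z i)"
  have ex: "\<not> C \<subseteq> ?Z (length S)"
    using end_empty C_nonempty by auto
  have m: "\<not> C \<subseteq> ?Z m" "m \<le> length S"
    unfolding m_def by (rule LeastI[of "\<lambda>i. \<not> C \<subseteq> ?Z i", OF ex], rule Least_le[of "\<lambda>i. \<not> C \<subseteq> ?Z i", OF ex])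
  have before: "C \<subseteq> ?Z i" if "i < m" for i
    using not_less_Least[of i "\<lambda>i. \<not> C \<subseteq> ?Z i"] that unfolding m_def by blast
  have "m \<noteq> 0"
    using m by (intro notI) simp
  then obtain p where p: "m = Suc p"
    using not0_implies_Suc by blast
  obtain v where v: "v \<in> C" "v \<notin> ?Z (Suc p)"
    using m p by blast
  have "C - {v} \<subseteq> S ! p"
  proof
    fix u assume u: "u \<in> C - {v}"
    then show "u \<in> S ! p"
      using spread[of u p v] before[of p] p v clique_edge[of v u] by auto
  qed
  then have Sp: "S ! p = C - {v}"
    using shot_eq v m p by simp
  have v_free: "v \<in> ?Z p" "v \<notin> S ! p"
    using before[of p] p v Sp by auto
  \<comment> \<open>Since \<open>S ! p\<close> lies inside \<open>C\<close>, a contaminated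
    \<open>w\<close> would escape and contaminate \<open>v\<close>.\<close>
  have outer_clean: "w \<notin> ?Z p" if "w \<in> I" "{w, v} \<in> E" for w
    using spread[of w p v] v that Sp disjoint by (auto simp: insert_commute)
  obtain w0 where w0: "w0 \<in> I" "{w0, v} \<in> E"
    using outer v by blast
  have "p \<noteq> 0"
    using outer_clean[OF w0] w0 by (intro notI) simp
  then obtain q where q: "p = Suc q"
    using not0_implies_Suc by blast
  \<comment> \<open>\<open>w\<close> is clean at index \<open>Suc q\<close> although its neighbour
    \<open>v\<close> is contaminated at \<open>q\<close>; so \<open>w\<close> is cleared at round
    \<open>Suc q\<close>, and \<open>v\<close> itself is shot there.\<close>
  have surrounded: "nbhd E w \<inter> ?Z q \<noteq> {}" "nbhd E w \<inter> ?Z q \<subseteq> S ! q" "v \<in> S ! q"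
    if w: "w \<in> I" "{w, v} \<in> E" for w
  proof -
    have "v \<in> nbhd E w \<inter> ?Z q"
      using w before[of q] p q v by (auto simp: nbhd_def insert_commute)
    moreover show "nbhd E w \<inter> ?Z q \<subseteq> S ! q"
      using outer_clean[OF w] spread[of _ q w] q by (auto simp: nbhd_def insert_commute)
    ultimately show "nbhd E w \<inter> ?Z q \<noteq> {}" "v \<in> S ! q"
      by auto
  qed
  have w0_back: "w0 \<in> ?Z (Suc p)"
    using spread[OF v_free w0(2)] .
  then have len1: "Suc p < length S"
    using end_empty m p by (metis empty_iff le_neq_implies_less)
  have w0_shot: "w0 \<in> S ! Suc p"
    using monotone_surroundedD[OF mono surrounded(1,2)[OF w0] _ len1 w0_back] q by simp
  \<comment> \<open>\<open>w0\<close> takes up one of the at most \<open>card C - 1\<close> shots,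
    too few are left to cover \<open>C - {v}\<close>.\<close>
  obtain u where u: "u \<in> C" "u \<noteq> v" "u \<notin> S ! Suc p"
  proof -
    have "\<not> insert w0 (C - {v}) \<subseteq> S ! Suc p"
    proof
      assume "insert w0 (C - {v}) \<subseteq> S ! Suc p"
      then have "card (insert w0 (C - {v})) \<le> card (S ! Suc p)"
        using card_mono fin len1 by blast
      moreover have "card (insert w0 (C - {v})) = card C"
        using w0 disjoint v finite_C card_Suc_Diff1[of C v] by (subst card_insert_disjoint) auto
      ultimately show False
        using few[OF len1] by simp
    qed
    then show ?thesis
      using that w0_shot by blast
  qed
  have u_free: "u \<in> ?Z (Suc p)"
    using spread[OF v_free] clique_edge u v by blast
  have u_spread: "x \<in> ?Z (Suc (Suc p))" if "{x, u} \<in> E" for x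
    using spread[OF u_free u(3) that] .
  have "v \<in> ?Z (Suc (Suc p))"
    using u_spread clique_edge u v by blast
  then have len2: "Suc (Suc p) < length S"
    using end_empty len1 by (metis empty_iff Suc_lessI)
  \<comment> \<open>All these vertices are contaminated by \<open>u\<close> and were shot before:
    \<open>v\<close> at index \<open>q\<close>, the others at index \<open>p\<close>.\<close>
  have "C - {u} \<subseteq> S ! Suc (Suc p)"
  proof
    fix x assume x: "x \<in> C - {u}"
    then have xZ: "x \<in> ?Z (Suc (Suc p))"
      using u_spread clique_edge u by blast
    show "x \<in> S ! Suc (Suc p)"
    proof (cases "x = v")
      case True
      then show ?thesis
        using monotone_shotD[OF mono S surrounded(3)[OF w0] _ len2] xZ q by simp
    next
      case False
      then have "x \<in> S ! p"
        using x Sp by simp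
      then show ?thesis
        using monotone_shotD[OF mono S _ _ len2 xZ] by simp
    qed
  qed
  then have shot_C: "S ! Suc (Suc p) \<subseteq> C"
    using shot_eq[OF _ len2] u by blast
  obtain w where w: "w \<in> I" "{w, u} \<in> E"
    using outer u by blast
  have wZ: "w \<in> ?Z (Suc (Suc p))"
    using u_spread w by blast
  have "w \<in> S ! Suc (Suc p)"
  \<comment> \<open>If \<open>w\<close> is adjacent to \<open>v\<close>, it was cleared at round
    \<open>Suc q\<close>. Otherwise its neighbours all lie in \<open>C - {v}\<close>, the shot at
    index \<open>p\<close>, and \<open>u\<close> is a contaminated one, so \<open>w\<close> was
    cleared at round \<open>Suc p\<close>.\<close>
  proof (cases "{w, v} \<in> E")
    case True
    then show ?thesis
      using monotone_surroundedD[OF mono surrounded(1,2)[OF w(1)] _ len2 wZ] q by simp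
  next
    case False
    have "nbhd E w \<subseteq> S ! p"
    proof
      fix x assume "x \<in> nbhd E w"
      then have "{x, w} \<in> E"
        by (simp add: nbhd_def)
      then show "x \<in> S ! p"
        using False edge_meets_C[of x w] w disjoint Sp by (auto simp: insert_commute)
    qed
    moreover have "u \<in> nbhd E w \<inter> ?Z p"
      using w u before[of p] p by (auto simp: nbhd_def insert_commute)
    ultimately show ?thesis
      using monotone_surroundedD[OF mono _ _ _ len2 wZ, of p] by blast
  qed
  then show False
    using shot_C w disjoint by auto
qed

section \<open>The two values of \<open>mh\<close>\<close>

lemma mh_eq_card:
  assumes "\<not> (\<exists>v\<in>C. simplicial (C \<union> I) E v)"
  shows "mh (C \<union> I) E = card C"
proof (rule mh_eq_two_shots)
  have outer: "\<forall>v\<in>C. \<exists>w\<in>I. {w, v} \<in> E"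
    using assms simplicial_iff_no_outer_neighbour by blast
  then show "card C \<le> hunters_used T"
    if "hunter_strategy (C \<union> I) T" "winning (C \<union> I) E T" "monotone_strategy (C \<union> I) E T" for T
    using monotone_lower_bound that by blast
  show "card (C \<union> I) \<noteq> 1"
  proof
    assume "card (C \<union> I) = 1"
    then obtain x where "C \<union> I = {x}"
      by (auto simp: card_1_singleton_iff)
    moreover obtain v w where "{w, v} \<in> E"
      using outer C_nonempty by blast
    ultimately show False
      using edge_in_V[of w v] by (metis singletonD)
  qed
qed (use C_nonempty edge_meets_C in auto)

lemma mh_eq_card_minus_one:
  assumes v: "v \<in> C" "simplicial (C \<union> I) E v"
  shows "mh (C \<union> I) E = card C - 1"
proof -
  have no_outer: "w \<in> C" if "{w, v} \<in> E" for w
    using that v simplicial_iff_no_outer_neighbour edge_in_V[OF that] by auto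
  have card_eq: "card (C - {v}) = card C - 1"
    using v by simp
  show ?thesis
  \<comment> \<open>If \<open>C = {v}\<close>, then \<open>v\<close> is isolated and connectedness
    leaves one vertex, where \<open>mh\<close> is 0 by convention. Otherwise \<open>C - {v}\<close>
    is a nonempty vertex cover.\<close>
  proof (cases "C = {v}")
    case True
    then have no_edge: "{w, v} \<notin> E" for w
      using no_outer[of w] edge_in_V[of w v] by auto
    have "x = v" if x: "x \<in> C \<union> I" for x
    proof -
      have "(x, v) \<in> {(x, y). {x, y} \<in> E}\<^sup>*"
        using connected x v unfolding connected_graph_def by blast
      then show ?thesis
        by (cases rule: rtranclE) (use no_edge in auto)
    qed
    then have "C \<union> I = {v}"
      using v by blast
    then show ?thesis
      unfolding mh_def by (simp only:) (simp add: True)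
  next
    case False
    then obtain u where u: "u \<in> C" "u \<noteq> v"
      using v by blast
    have "card {u, v} \<le> card (C \<union> I)"
      using u v finite_V by (intro card_mono) auto
    then have card_V: "card (C \<union> I) \<noteq> 1"
      using u by simp
    have covered: "y \<in> C - {v}" if xy: "{x, y} \<in> E" and x: "x \<notin> C - {v}" for x y
    proof (cases "x = v")
      case True
      then show ?thesis
        using no_outer[of y] edge_in_V[OF xy] xy by (auto simp: insert_commute)
    next
      case False
      then show ?thesis
        using no_outer[of x] edge_meets_C[OF xy] xy x by auto
    qed
    have "mh (C \<union> I) E = card (C - {v})"
    proof (rule mh_eq_two_shots[OF card_V _ _ covered])
      show "card (C - {v}) \<le> hunters_used T"
        if "hunter_strategy (C \<union> I) T" "winning (C \<union> I) E T" for T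
        using winning_clique_bound[OF finite_V clique_C that] card_eq by simp
    qed (use u in auto)
    then show ?thesis
      using card_eq by simp
  qed
qed

end

theorem theorem4p6:
  fixes C I :: "'a set" and E :: "'a set set"
  assumes "simple_graph (C \<union> I) E"
    and "connected_graph (C \<union> I) E"
    and "C \<inter> I = {}"
    and "maximal_clique (C \<union> I) E C"
    and "independent_set (C \<union> I) E I"
  shows "(mh (C \<union> I) E = card C - 1 \<longleftrightarrow> (\<exists>v\<in>C. simplicial (C \<union> I) E v))
    \<and> (\<not> (\<exists>v\<in>C. simplicial (C \<union> I) E v) \<longrightarrow> mh (C \<union> I) E = card C)"
proof -
  interpret split_graph C I E
    by unfold_locales (fact assms)+
  \<comment> \<open>This makes the two values distinct despite truncated subtraction, which gives
    the forward direction of the equivalence.\<close>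
  have "card C \<noteq> 0"
    using finite_C C_nonempty by simp
  then have "card C \<noteq> card C - 1"
    by simp
  then show ?thesis
    using mh_eq_card mh_eq_card_minus_one by metis
qed

end
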